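(* Let $\widetilde F:\mathbb R^m\to\mathbb R$ be continuously differentiable with $L$-Lipschitz gradient: $\|\nabla\widetilde F(x)-\nabla\widetilde F(y)\|_2\le L\|x-y\|_2$ for all $x,y\in\mathbb R^m$. Let $(z_k)_{k\in\mathbb N_0}$ be defined by $z_{k+1}=z_k+t_ks_k$, with $z_0\in\mathbb R^m$ and $t_k>0$, and for each $k$ let $g_k=\overline\nabla\widetilde F(z_k)\in\mathbb R^m$ be the inexact gradient at $z_k$. Suppose that: (i) there is $\widetilde F_{\inf}\in\mathbb R$ with $\widetilde F(z_k)\ge\widetilde F_{\inf}$ for all $k\in\mathbb N_0$; (ii) there are $c_1',c_2'>0$ with $c_1'/c_2'\le1$ such that $c_1'\|g_k\|_2^2\le-g_k^{\mathsf T}s_k$ and $\|s_k\|_2\le c_2'\|g_k\|_2$ for all $k\in\mathbb N_0$; (iii) for some $\zeta\in[0,c_1'/c_2')$, $\|g_k-\nabla\widetilde F(z_k)\|_2\le\zeta\|g_k\|_2$ for all $k\in\mathbb N_0$; (iv) $\lim_{k\to\infty}t_k=0$ and $\sum_{k=0}^\infty t_k=\infty$. Then $$\lim_{k\to\infty}\nabla\widetilde F(z_k)=0,\qquad\lim_{k\to\infty}\overline\nabla\widetilde F(z_k)=0.$$ Moreover, every limit point of $(z_k)_{k\in\mathbb N_0}$ is stationary for $\widetilde F$.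
   Context: $\|\cdot\|_2$ is the Euclidean norm and $\mathbb N_0=\{0,1,2,\dots\}$. The inexact gradient $\overline\nabla\widetilde F(z_k)$ is an arbitrary vector in $\mathbb R^m$ approximating $\nabla\widetilde F(z_k)$, subject only to the stated hypotheses. A limit point of a sequence is the limit of some subsequence; a stationary point is a point where $\nabla\widetilde F$ vanishes. *)

theory Defs
  imports "HOL-Analysis.Analysis"
begin

(* A limit point of a sequence is a subsequential limit; a value attained infinitely often
   counts, so this is not the topological islimpt of the range of the sequence. *)
definition seq_limit_point :: "(nat \<Rightarrow> 'a::topological_space) \<Rightarrow> 'a \<Rightarrow> bool" where
  "seq_limit_point z x \<longleftrightarrow> (\<exists>r :: nat \<Rightarrow> nat. strict_mono r \<and> (z \<circ> r) \<longlonglongrightarrow> x)"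

definition stationary_point :: "('a::real_inner \<Rightarrow> real) \<Rightarrow> 'a \<Rightarrow> bool" where
  "stationary_point F x \<longleftrightarrow> GDERIV F x :> 0"

end

theory Submission
  imports Defs
begin

text \<open>Writing \<open>v\<^sub>k = \<parallel>\<nabla>F(z\<^sub>k)\<parallel>\<^sup>2\<close>, the descent lemma and the vanishing step sizes make \<open>F(z\<^sub>k)\<close> eventually
  decrease by at least a multiple of \<open>t\<^sub>k \<parallel>g\<^sub>k\<parallel>\<^sup>2\<close>, so \<open>\<Sum> t\<^sub>k v\<^sub>k\<close> converges. Lipschitz continuity of the
  gradient gives \<open>\<bar>v\<^sub>k\<^sub>+\<^sub>1 - v\<^sub>k\<bar> \<le> C t\<^sub>k v\<^sub>k\<close>. Hence \<open>v\<close> has summable increments, so it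
  converges, and as \<open>\<Sum> t\<^sub>k\<close> diverges its limit is zero.\<close>

text \<open>The mean value theorem along the segment from \<open>x\<close> to \<open>x + d\<close>
  reduces everything to one intermediate gradient. This yields \<open>L\<close> rather than the
  sharper \<open>L / 2\<close>, which is harmless here: the term is of second order in step sizes
  that vanish.\<close>

lemma descent_lemma:
  fixes F :: "'a::real_inner \<Rightarrow> real" and G :: "'a \<Rightarrow> 'a"
  assumes grad: "\<And>x. GDERIV F x :> G x"
    and lip: "\<And>x y. norm (G x - G y) \<le> L * norm (x - y)"
  shows "F (x + d) \<le> F x + G x \<bullet> d + L * (norm d)\<^sup>2"
proof -
  have "\<exists>\<xi>\<in>{0<..<1}. F (x + 1 *\<^sub>R d) - F (x + 0 *\<^sub>R d) = (1 - 0) * (G (x + \<xi> *\<^sub>R d) \<bullet> d)"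
  proof (rule mvt_simple)
    fix \<tau> :: real
    have "((\<lambda>\<tau>. x + \<tau> *\<^sub>R d) has_derivative (\<lambda>h. h *\<^sub>R d)) (at \<tau> within {0..1})"
      by (auto intro!: derivative_eq_intros)
    moreover have "(F has_derivative (\<lambda>h. h \<bullet> G (x + \<tau> *\<^sub>R d))) (at (x + \<tau> *\<^sub>R d))"
      using grad by (simp add: gderiv_def)
    ultimately have "((\<lambda>\<tau>. F (x + \<tau> *\<^sub>R d)) has_derivative
        (\<lambda>h. (h *\<^sub>R d) \<bullet> G (x + \<tau> *\<^sub>R d))) (at \<tau> within {0..1})"
      by (rule has_derivative_compose)
    then show "((\<lambda>\<tau>. F (x + \<tau> *\<^sub>R d)) has_derivative (\<lambda>h. h * (G (x + \<tau> *\<^sub>R d) \<bullet> d))) (at \<tau> within {0..1})"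
      by (simp add: inner_commute)
  qed simp
  then obtain \<xi> :: real where \<xi>: "0 < \<xi>" "\<xi> < 1" and mvt: "F (x + d) - F x = G (x + \<xi> *\<^sub>R d) \<bullet> d"
    by auto
  \<comment> \<open>Only the product has a known sign: in a trivial space \<open>L\<close> could be
    negative.\<close>
  have L: "0 \<le> L * norm d"
    using lip[of d 0] norm_ge_zero[of "G d - G 0"] by (simp del: norm_ge_zero)
  have "(G (x + \<xi> *\<^sub>R d) - G x) \<bullet> d \<le> norm (G (x + \<xi> *\<^sub>R d) - G x) * norm d"
    by (rule norm_cauchy_schwarz)
  also have "\<dots> \<le> L * norm (\<xi> *\<^sub>R d) * norm d"
    using lip[of "x + \<xi> *\<^sub>R d" x] by (intro mult_right_mono) auto
  also have "\<dots> = \<xi> * (L * norm d * norm d)"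
    using \<xi> by simp
  also have "\<dots> \<le> L * (norm d)\<^sup>2"
    using \<xi> mult_left_le_one_le[OF mult_nonneg_nonneg[OF L norm_ge_zero], of \<xi> d]
    by (simp add: power2_eq_square mult.assoc)
  finally show ?thesis
    using mvt by (simp add: inner_diff_left)
qed

text \<open>Summability of \<open>t k * v k\<close> against a divergent \<open>\<Sum> t\<close>
  alone gives only a lower limit of zero. The increment bound excludes oscillation by forcing
  \<open>v\<close> to converge.\<close>

lemma tendsto_zero_if_summable_weighted:
  fixes v t :: "nat \<Rightarrow> real"
  assumes v_nonneg: "\<And>k. 0 \<le> v k"
    and t_nonneg: "\<And>k. 0 \<le> t k"
    and summ: "summable (\<lambda>k. t k * v k)"
    and incr: "\<forall>\<^sub>F k in sequentially. \<bar>v (Suc k) - v k\<bar> \<le> C * (t k * v k)"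
    and div: "filterlim (\<lambda>n. \<Sum>k<n. t k) at_top sequentially"
  shows "v \<longlonglongrightarrow> 0"
proof -
  have "summable (\<lambda>k. v (Suc k) - v k)"
    by (rule summable_comparison_test_ev[OF _ summable_mult[OF summ, of C]]) (use incr in simp)
  then have "convergent (\<lambda>n. \<Sum>k<n. v (Suc k) - v k)"
    by (simp add: summable_iff_convergent)
  then have "convergent (\<lambda>n. v n - v 0)"
    by (simp add: sum_lessThan_telescope)
  then obtain l where "(\<lambda>n. v n - v 0) \<longlonglongrightarrow> l"
    by (auto simp: convergent_def)
  from tendsto_add[OF this tendsto_const[of "v 0"]] obtain m where m: "v \<longlonglongrightarrow> m"
    by auto
  have "0 \<le> m"
    using m v_nonneg by (auto intro: LIMSEQ_le_const)
  moreover have "\<not> 0 < m"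
  proof
    assume "0 < m"
    then have "\<forall>\<^sub>F k in sequentially. m / 2 < v k"
      using m by (intro order_tendstoD) auto
    \<comment> \<open>Once \<open>v k\<close> exceeds half its limit, \<open>t k\<close> is
      dominated by a multiple of a summable term, against the divergence of its sum.\<close>
    then have "\<forall>\<^sub>F k in sequentially. norm (t k) \<le> (2 / m) * (t k * v k)"
    proof eventually_elim
      case (elim k)
      then have "t k * (m / 2) \<le> t k * v k"
        using t_nonneg by (intro mult_left_mono) auto
      then show ?case
        using \<open>0 < m\<close> t_nonneg[of k] by (simp add: field_simps)
    qed
    then have "summable t"
      by (rule summable_comparison_test_ev) (intro summable_mult summ)
    then have "(\<lambda>n. \<Sum>k<n. t k) \<longlonglongrightarrow> suminf t"
      by (rule summable_LIMSEQ)
    with div show False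
      using not_tendsto_and_filterlim_at_infinity[of sequentially "\<lambda>n. \<Sum>k<n. t k" "suminf t"]
        filterlim_at_top_imp_at_infinity by auto
  qed
  ultimately show ?thesis
    using m by simp
qed

text \<open>Beyond the index \<open>K\<close> from which the decrease holds, partial sums telescope
  and stay below \<open>f K - B\<close>; finitely many earlier terms do not affect
  convergence.\<close>

lemma summable_if_sufficient_decrease:
  fixes f w :: "nat \<Rightarrow> real"
  assumes decr: "\<forall>\<^sub>F k in sequentially. w k \<le> f k - f (Suc k)"
    and w_nonneg: "\<And>k. 0 \<le> w k"
    and bdd: "\<And>k. B \<le> f k"
  shows "summable w"
proof -
  obtain K where K: "\<And>k. k \<ge> K \<Longrightarrow> w k \<le> f k - f (Suc k)"
    using decr by (auto simp: eventually_sequentially)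
  have "summable (\<lambda>k. w (k + K))"
  proof (rule bounded_imp_summable)
    fix n
    have "(\<Sum>k\<le>n. w (k + K)) \<le> (\<Sum>k\<le>n. f (k + K) - f (Suc k + K))"
      using K by (intro sum_mono) simp
    also have "\<dots> = f K - f (Suc n + K)"
      using sum_telescope[of "\<lambda>k. f (k + K)" n] by simp
    also have "\<dots> \<le> f K - B"
      using bdd by simp
    finally show "(\<Sum>k\<le>n. w (k + K)) \<le> f K - B" .
  qed (rule w_nonneg)
  then show ?thesis
    by (simp add: summable_iff_shift)
qed

theorem theorem5p8:
  fixes F :: "real ^ 'm \<Rightarrow> real"
    and gradF :: "real ^ 'm \<Rightarrow> real ^ 'm"
    and L F_inf c1 c2 \<zeta> :: real
    and z s g :: "nat \<Rightarrow> real ^ 'm"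
    and t :: "nat \<Rightarrow> real"
  assumes grad: "\<And>x. GDERIV F x :> gradF x"
    and grad_cont: "continuous_on UNIV gradF"
    and grad_lipschitz: "\<And>x y. norm (gradF x - gradF y) \<le> L * norm (x - y)"
    and step: "\<And>k. z (Suc k) = z k + t k *\<^sub>R s k"
    and t_pos: "\<And>k. t k > 0"
    and F_bounded_below: "\<And>k. F (z k) \<ge> F_inf"
    and c_pos: "c1 > 0" "c2 > 0"
    and c_ratio: "c1 / c2 \<le> 1"
    and descent: "\<And>k. c1 * (norm (g k))\<^sup>2 \<le> - (g k \<bullet> s k)"
    and step_norm: "\<And>k. norm (s k) \<le> c2 * norm (g k)"
    and zeta: "\<zeta> \<in> {0..<c1 / c2}"
    and inexact: "\<And>k. norm (g k - gradF (z k)) \<le> \<zeta> * norm (g k)"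
    and t_tendsto: "t \<longlonglongrightarrow> 0"
    and t_diverges: "filterlim (\<lambda>n. \<Sum>k<n. t k) at_top sequentially"
  shows "(\<lambda>k. gradF (z k)) \<longlonglongrightarrow> 0 \<and> g \<longlonglongrightarrow> 0
    \<and> (\<forall>x. seq_limit_point z x \<longrightarrow> stationary_point F x)"
proof -
  \<comment> \<open>The descent rate that survives the gradient error; positive because
    \<open>\<zeta> < c1 / c2\<close>.\<close>
  define a where "a = c1 - \<zeta> * c2"
  \<comment> \<open>Relative gradient change per unit step size: Lipschitz constant, times the bound
    on \<open>s k\<close> by \<open>g k\<close>, times the bound on \<open>g k\<close> by the true
    gradient.\<close>
  define M where "M = L * c2 / (1 - \<zeta>)"
  define v where "v k = (norm (gradF (z k)))\<^sup>2" for k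
  have \<zeta>: "0 \<le> \<zeta>" "\<zeta> < 1"
    using zeta c_ratio by auto
  have a: "0 < a"
    using zeta c_pos by (simp add: a_def pos_less_divide_eq)
  have L: "0 \<le> L"
  proof -
    \<comment> \<open>A unit vector exists in every \<open>real ^ 'm\<close>, so comparing the
      gradients at \<open>e\<close> and \<open>0\<close> fixes the sign of \<open>L\<close>.\<close>
    obtain e :: "real ^ 'm" where "norm e = 1"
      using vector_choose_size[of 1] by auto
    then show ?thesis
      using grad_lipschitz[of e 0] norm_ge_zero[of "gradF e - gradF 0"] by (simp del: norm_ge_zero)
  qed
  have M: "0 \<le> M"
    using L c_pos \<zeta> by (simp add: M_def)
  have g_le: "norm (g k) \<le> norm (gradF (z k)) / (1 - \<zeta>)" for k
  proof -
    have "norm (g k) \<le> norm (gradF (z k)) + norm (g k - gradF (z k))"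
      by (rule norm_triangle_sub)
    then show ?thesis
      using inexact[of k] \<zeta> by (simp add: pos_le_divide_eq algebra_simps)
  qed
  have grad_le: "norm (gradF (z k)) \<le> 2 * norm (g k)" for k
  proof -
    have "norm (gradF (z k)) \<le> norm (g k) + norm (g k - gradF (z k))"
      using norm_triangle_sub[of "gradF (z k)" "g k"] by (simp add: norm_minus_commute)
    also have "\<dots> \<le> norm (g k) + 1 * norm (g k)"
      using inexact[of k] \<zeta> mult_right_mono[of \<zeta> 1 "norm (g k)"] by simp
    finally show ?thesis by simp
  qed
  \<comment> \<open>Replacing \<open>g k\<close> by the true gradient costs at most
    \<open>\<zeta> * c2 * (norm (g k))\<^sup>2\<close>, by Cauchy-Schwarz.\<close>
  have slope: "gradF (z k) \<bullet> s k \<le> - a * (norm (g k))\<^sup>2" for k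
  proof -
    have "(gradF (z k) - g k) \<bullet> s k \<le> norm (gradF (z k) - g k) * norm (s k)"
      by (rule norm_cauchy_schwarz)
    also have "\<dots> \<le> (\<zeta> * norm (g k)) * (c2 * norm (g k))"
      using inexact[of k] step_norm[of k] \<zeta> by (intro mult_mono) (auto simp: norm_minus_commute)
    finally show ?thesis
      using descent[of k] by (simp add: a_def inner_diff_left power2_eq_square algebra_simps)
  qed
  have decrease: "F (z (Suc k)) \<le> F (z k) - t k * (a - L * c2\<^sup>2 * t k) * (norm (g k))\<^sup>2" for k
  proof -
    have "F (z (Suc k)) \<le> F (z k) + t k * (gradF (z k) \<bullet> s k) + L * (t k)\<^sup>2 * (norm (s k))\<^sup>2"
      using descent_lemma[OF grad grad_lipschitz, of "z k" "t k *\<^sub>R s k"]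
      by (simp add: step power_mult_distrib mult.assoc)
    also have "\<dots> \<le> F (z k) + t k * (- a * (norm (g k))\<^sup>2) + L * (t k)\<^sup>2 * (c2 * norm (g k))\<^sup>2"
      using slope[of k] t_pos[of k] L step_norm[of k]
      by (intro add_mono mult_left_mono power_mono) auto
    finally show ?thesis
      by (simp add: power2_eq_square algebra_simps)
  qed
  \<comment> \<open>As \<open>t k\<close> vanishes, the second-order loss eventually uses up less
    than half of the rate \<open>a\<close>.\<close>
  have "(\<lambda>k. a - L * c2\<^sup>2 * t k) \<longlonglongrightarrow> a - L * c2\<^sup>2 * 0"
    by (intro tendsto_intros t_tendsto)
  then have "\<forall>\<^sub>F k in sequentially. a / 2 < a - L * c2\<^sup>2 * t k"
    using a by (intro order_tendstoD(1)) auto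
  then have "\<forall>\<^sub>F k in sequentially. (a / 2) * (t k * (norm (g k))\<^sup>2) \<le> F (z k) - F (z (Suc k))"
  proof eventually_elim
    case (elim k)
    then have "(a / 2) * (t k * (norm (g k))\<^sup>2) \<le> (a - L * c2\<^sup>2 * t k) * (t k * (norm (g k))\<^sup>2)"
      using t_pos[of k] by (intro mult_right_mono) auto
    then show ?case
      using decrease[of k] by (simp add: algebra_simps)
  qed
  then have "summable (\<lambda>k. (a / 2) * (t k * (norm (g k))\<^sup>2))"
    by (rule summable_if_sufficient_decrease[where B = F_inf])
      (use a t_pos F_bounded_below in \<open>auto intro!: mult_nonneg_nonneg simp: less_imp_le\<close>)
  then have "summable (\<lambda>k. t k * (norm (g k))\<^sup>2)"
    using a by (subst (asm) summable_cmult_iff) auto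
  then have summable_g: "summable (\<lambda>k. 4 * (t k * (norm (g k))\<^sup>2))"
    by (rule summable_mult)
  have summable_v: "summable (\<lambda>k. t k * v k)"
  proof (rule summable_comparison_test'[OF summable_g, of 0])
    fix k
    \<comment> \<open>The factor 4 is the square of the 2 in \<open>grad_le\<close>.\<close>
    have "t k * v k \<le> t k * (2 * norm (g k))\<^sup>2"
      unfolding v_def using grad_le[of k] t_pos[of k] by (intro mult_left_mono power_mono) auto
    then show "norm (t k * v k) \<le> 4 * (t k * (norm (g k))\<^sup>2)"
      using t_pos[of k] by (simp add: power_mult_distrib v_def)
  qed
  have grad_step: "norm (gradF (z (Suc k)) - gradF (z k)) \<le> M * t k * norm (gradF (z k))" for k
  proof -
    have "norm (gradF (z (Suc k)) - gradF (z k)) \<le> L * (t k * norm (s k))"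
      using grad_lipschitz[of "z (Suc k)" "z k"] t_pos[of k] by (simp add: step)
    also have "\<dots> \<le> L * (t k * (c2 * (norm (gradF (z k)) / (1 - \<zeta>))))"
      using L t_pos[of k] c_pos g_le[of k]
      by (intro mult_left_mono order_trans[OF step_norm]) auto
    finally show ?thesis
      by (simp add: M_def mult_ac)
  qed
  have "\<forall>\<^sub>F k in sequentially. t k < 1"
    using t_tendsto by (intro order_tendstoD(2)) auto
  then have "\<forall>\<^sub>F k in sequentially. \<bar>v (Suc k) - v k\<bar> \<le> (M * (2 + M)) * (t k * v k)"
  proof eventually_elim
    case (elim k)
    let ?p = "norm (gradF (z (Suc k)))" and ?q = "norm (gradF (z k))"
    have pq: "\<bar>?p - ?q\<bar> \<le> M * t k * ?q"
      using grad_step[of k] norm_triangle_ineq3[of "gradF (z (Suc k))" "gradF (z k)"] by linarith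
    \<comment> \<open>Here \<open>t k < 1\<close> enters: it gives
      \<open>?p \<le> (1 + M) * ?q\<close>. In the difference of squares, the factor
      \<open>?p + ?q\<close> is then at most a constant times \<open>?q\<close>, while
      \<open>?p - ?q\<close> supplies the factor \<open>t k\<close>.\<close>
    moreover have "M * t k * ?q \<le> M * 1 * ?q"
      using M elim t_pos[of k] by (intro mult_mono) auto
    ultimately have "\<bar>?p + ?q\<bar> \<le> (2 + M) * ?q"
      by (simp add: algebra_simps)
    with pq have "\<bar>?p - ?q\<bar> * \<bar>?p + ?q\<bar> \<le> (M * t k * ?q) * ((2 + M) * ?q)"
      using M t_pos[of k] by (intro mult_mono) auto
    moreover have "v (Suc k) - v k = (?p - ?q) * (?p + ?q)"
      by (simp add: v_def power2_eq_square algebra_simps)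
    ultimately show ?case
      by (simp add: v_def abs_mult power2_eq_square mult_ac)
  qed
  then have "v \<longlonglongrightarrow> 0"
    using t_pos by (intro tendsto_zero_if_summable_weighted[OF _ _ summable_v _ t_diverges])
      (auto simp: v_def less_imp_le)
  then have grad_lim: "(\<lambda>k. gradF (z k)) \<longlonglongrightarrow> 0"
    using tendsto_real_sqrt[of v 0 sequentially]
    by (simp add: v_def tendsto_norm_zero_iff)
  have "(\<lambda>k. norm (gradF (z k)) / (1 - \<zeta>)) \<longlonglongrightarrow> 0 / (1 - \<zeta>)"
    using \<zeta> by (intro tendsto_divide tendsto_norm_zero grad_lim tendsto_const) auto
  \<comment> \<open>Squeezed by the true gradient through \<open>g_le\<close>.\<close>
  then have g_lim: "g \<longlonglongrightarrow> 0"
    using g_le by (intro Lim_null_comparison[of g]) auto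
  have "stationary_point F x" if limit_point: "seq_limit_point z x" for x
  proof -
    obtain r where r: "strict_mono r" "(z \<circ> r) \<longlonglongrightarrow> x"
      using limit_point by (auto simp: seq_limit_point_def)
    have "isCont gradF x"
      using grad_cont by (simp add: continuous_on_eq_continuous_at)
    \<comment> \<open>Along the subsequence the gradients tend both to \<open>gradF x\<close>, by
      continuity, and to zero.\<close>
    then have "(\<lambda>k. gradF ((z \<circ> r) k)) \<longlonglongrightarrow> gradF x"
      using r(2) by (rule isCont_tendsto_compose)
    moreover have "(\<lambda>k. gradF ((z \<circ> r) k)) \<longlonglongrightarrow> 0"
      using LIMSEQ_subseq_LIMSEQ[OF grad_lim r(1)] by (simp add: o_def)
    ultimately have "gradF x = 0"
      by (rule LIMSEQ_unique)
    then show ?thesis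
      using grad[of x] by (simp add: stationary_point_def)
  qed
  with grad_lim g_lim show ?thesis
    by blast
qed

end
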